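(* Let $G$ be a triangle-free analytic graph on a Polish space $X$ with at least one edge. Then there is no Borel homomorphism from $G^{*}$ to $G$.
   Context: A graph on $X$ is identified with its edge relation; it is analytic if the edge relation is an analytic subset of $X\times X$. A homomorphism from a graph $G$ on $X$ to a graph $H$ on $Y$ is a map $h\colon X\to Y$ with $x\mathrel{G}y\Rightarrow h(x)\mathrel{H}h(y)$. $G^{*}$ is the graph on $X^\omega$ (product topology) with $x\mathrel{G^{*}}y$ iff there is $n$ such that $x(i)\mathrel{G}y(i)$ for all $i\ge n$. *)

theory Defs
  imports "HOL-Analysis.Analysis"
begin

definition graph :: "('a \<times> 'a) set \<Rightarrow> bool" where
  "graph G \<longleftrightarrow> sym G \<and> irrefl G"

definition triangle_free :: "('a \<times> 'a) set \<Rightarrow> bool" where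
  "triangle_free G \<longleftrightarrow> \<not> (\<exists>x y z. (x, y) \<in> G \<and> (y, z) \<in> G \<and> (x, z) \<in> G)"

text \<open>A set is analytic if it is empty or a continuous image of the Baire space. The latter is
  the type \<^typ>\<open>nat \<Rightarrow> nat\<close>, whose library topology is the product of the discrete topologies.\<close>

definition analytic_set :: "'a::topological_space set \<Rightarrow> bool" where
  "analytic_set A \<longleftrightarrow>
     A = {} \<or> (\<exists>f :: (nat \<Rightarrow> nat) \<Rightarrow> 'a. continuous_on UNIV f \<and> A = range f)"

definition graph_hom :: "('a \<times> 'a) set \<Rightarrow> ('b \<times> 'b) set \<Rightarrow> ('a \<Rightarrow> 'b) \<Rightarrow> bool" where
  "graph_hom G H h \<longleftrightarrow> (\<forall>x y. (x, y) \<in> G \<longrightarrow> (h x, h y) \<in> H)"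

definition star_graph :: "('a \<times> 'a) set \<Rightarrow> ((nat \<Rightarrow> 'a) \<times> (nat \<Rightarrow> 'a)) set" where
  "star_graph G = {(x, y). \<exists>n. \<forall>i\<ge>n. (x i, y i) \<in> G}"

end

theory Submission
  imports Defs
begin

text \<open>
  Write \<open>G\<close> as the range of a continuous \<open>f\<close> on the Baire space. A triangle is then an infinite branch of
  a tree of finite attempts, each fixing initial segments of codes for three edges whose endpoints nearly
  match. If there is no such branch, then by Koenig's lemma the tree \<open>T\<close> of all sequences pointwise above
  some attempt is well-founded, so applying \<open>h\<close> at the nodes of \<open>T\<close> and an edge \<open>(a, b)\<close> at its leaves
  gives a function \<open>u\<close> on labellings of the leaves; \<open>u\<close> has the Baire property and sends two labellings
  that differ modulo the iterated Frechet ideal of \<open>T\<close> to adjacent vertices. Three labellings of a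
  well-founded tree cannot differ pairwise in this sense, but finite approximations can: by a category
  argument one builds, step by step, three pairwise generic pairs, choosing the strategies so large that
  the conflict is postponed to sequences above the attempt obtained so far, and these are not
  leaves of \<open>T\<close>. The codes of the edges decided on the way form an infinite branch after all.
\<close>

subsection \<open>Baire category in products of discrete spaces\<close>

text \<open>A pair of a finite set \<open>D\<close> and a point \<open>x\<close> of \<open>R\<close> acts as a forcing condition: only the
  restriction of \<open>x\<close> to \<open>D\<close> matters. All notions are relative to \<open>R\<close>, with the topology induced by
  the product of discrete spaces.\<close>
definition cylinder :: "('i \<Rightarrow> 'b) set \<Rightarrow> 'i set \<Rightarrow> ('i \<Rightarrow> 'b) \<Rightarrow> ('i \<Rightarrow> 'b) set" where
  "cylinder R D x = {y \<in> R. \<forall>i\<in>D. y i = x i}"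

definition extends :: "('i \<Rightarrow> 'b) set \<Rightarrow> 'i set \<Rightarrow> ('i \<Rightarrow> 'b) \<Rightarrow> 'i set \<Rightarrow> ('i \<Rightarrow> 'b) \<Rightarrow> bool" where
  "extends R D x D' x' \<longleftrightarrow> finite D' \<and> D \<subseteq> D' \<and> x' \<in> R \<and> (\<forall>i\<in>D. x' i = x i)"

definition nwd :: "('i \<Rightarrow> 'b) set \<Rightarrow> ('i \<Rightarrow> 'b) set \<Rightarrow> bool" where
  "nwd R N \<longleftrightarrow> (\<forall>D x. finite D \<longrightarrow> x \<in> R \<longrightarrow>
     (\<exists>D' x'. extends R D x D' x' \<and> cylinder R D' x' \<inter> N = {}))"

definition meagre :: "('i \<Rightarrow> 'b) set \<Rightarrow> ('i \<Rightarrow> 'b) set \<Rightarrow> bool" where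
  "meagre R M \<longleftrightarrow> (\<exists>N :: nat \<Rightarrow> _. (\<forall>n. nwd R (N n)) \<and> M \<subseteq> (\<Union>n. N n))"

definition pointwise_closed :: "('i \<Rightarrow> 'b) set \<Rightarrow> bool" where
  "pointwise_closed R \<longleftrightarrow> (\<forall>x. (\<forall>D. finite D \<longrightarrow> (\<exists>y\<in>R. \<forall>i\<in>D. y i = x i)) \<longrightarrow> x \<in> R)"

text \<open>The role of forcing \<open>A\<close>, with no regularity of \<open>A\<close> assumed:
  after an extension it passes from a countable union to one of the members, see
  \<open>big_UN\<close>.\<close>

definition big :: "('i \<Rightarrow> 'b) set \<Rightarrow> 'i set \<Rightarrow> ('i \<Rightarrow> 'b) \<Rightarrow> ('i \<Rightarrow> 'b) set \<Rightarrow> bool" where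
  "big R D x A \<longleftrightarrow> (\<forall>D' x'. extends R D x D' x' \<longrightarrow> \<not> meagre R (A \<inter> cylinder R D' x'))"

lemma extends_refl: "finite D \<Longrightarrow> x \<in> R \<Longrightarrow> extends R D x D x"
  by (auto simp: extends_def)

lemma extends_trans: "extends R D x D' x' \<Longrightarrow> extends R D' x' D'' x'' \<Longrightarrow> extends R D x D'' x''"
  unfolding extends_def by (metis subset_eq)

lemma cylinder_mono: "extends R D x D' x' \<Longrightarrow> cylinder R D' x' \<subseteq> cylinder R D x"
  unfolding extends_def cylinder_def by (auto simp: subset_iff)

lemma nwd_empty: "nwd R {}"
  unfolding nwd_def using extends_refl by fastforce

lemma meagre_subset: "meagre R M \<Longrightarrow> M' \<subseteq> M \<Longrightarrow> meagre R M'"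
  unfolding meagre_def by (meson order_trans)

lemma nwd_imp_meagre: "nwd R N \<Longrightarrow> meagre R N"
  unfolding meagre_def by (rule exI[of _ "\<lambda>_. N"]) auto

lemma meagre_UN:
  assumes "\<And>n::nat. meagre R (M n)" shows "meagre R (\<Union>n. M n)"
proof -
  from assms obtain N where N: "\<And>n m. nwd R (N n (m::nat))" "\<And>n. M n \<subseteq> (\<Union>m. N n m)"
    unfolding meagre_def by metis
  have "nwd R (case prod_decode k of (n, m) \<Rightarrow> N n m)" for k
    using N(1) by (simp split: prod.split)
  moreover have "(\<Union>n. M n) \<subseteq> (\<Union>k. case prod_decode k of (n, m) \<Rightarrow> N n m)"
  proof
    fix x assume "x \<in> (\<Union>n. M n)"
    then obtain n m where "x \<in> N n m" using N(2) by blast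
    then show "x \<in> (\<Union>k. case prod_decode k of (n, m) \<Rightarrow> N n m)"
      by (intro UN_I[of "prod_encode (n, m)"]) simp_all
  qed
  ultimately show ?thesis unfolding meagre_def
    by (intro exI[of _ "\<lambda>k. case prod_decode k of (n, m) \<Rightarrow> N n m"]) blast
qed

lemma meagre_empty: "meagre R {}"
  by (rule nwd_imp_meagre[OF nwd_empty])

lemma meagre_UN_countable:
  assumes "countable I" "\<And>i. i \<in> I \<Longrightarrow> meagre R (M i)" shows "meagre R (\<Union>i\<in>I. M i)"
proof (cases "I = {}")
  case False
  have "meagre R (\<Union>n. M (from_nat_into I n))"
    by (rule meagre_UN) (simp add: assms False from_nat_into)
  also have "(\<Union>n. M (from_nat_into I n)) = (\<Union>i\<in>I. M i)"
    using range_from_nat_into[OF False assms(1)] by (metis image_image)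
  finally show ?thesis .
qed (simp add: meagre_empty)

lemma meagre_Un:
  assumes "meagre R A" "meagre R B" shows "meagre R (A \<union> B)"
proof -
  have "meagre R (\<Union>C\<in>{A, B}. C)" by (rule meagre_UN_countable) (auto simp: assms)
  then show ?thesis by simp
qed

text \<open>The n-th extension avoids \<open>N n\<close> and fixes the coordinate numbered
  \<open>n\<close>, so the conditions converge to a point; closedness puts it into \<open>R\<close>,
  and it lies outside every \<open>N n\<close>.\<close>

theorem not_meagre_cylinder:
  fixes R :: "('i::countable \<Rightarrow> 'b) set"
  assumes R: "pointwise_closed R" and D: "finite D" and x: "x \<in> R"
  shows "\<not> meagre R (cylinder R D x)"
proof
  assume "meagre R (cylinder R D x)"
  then obtain N where N: "\<And>n::nat. nwd R (N n)" "cylinder R D x \<subseteq> (\<Union>n. N n)"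
    unfolding meagre_def by blast
  define P where "P = (\<lambda>(n::nat) p. extends R D x (fst p) (snd p))"
  define S where "S = (\<lambda>n p p'. extends R (fst p) (snd p) (fst p') (snd p') \<and>
     cylinder R (fst p') (snd p') \<inter> N n = {} \<and> (\<forall>i. to_nat i = n \<longrightarrow> i \<in> fst p'))"
  have "\<exists>q. P 0 q" using extends_refl[OF D x] by (auto simp: P_def)
  moreover have "\<exists>p'. P (Suc n) p' \<and> S n p p'" if "P n p" for n p
  proof -
    define E where "E = fst p \<union> {i. to_nat i = n}"
    have fin: "finite E"
    proof -
      have "{i::'i. to_nat i = n} \<subseteq> {from_nat n}" by auto
      then show ?thesis using that unfolding E_def P_def extends_def
        by (meson finite.emptyI finite.insertI finite_UnI finite_subset)
    qed
    have e1: "extends R (fst p) (snd p) E (snd p)"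
      using that fin unfolding E_def P_def extends_def by auto
    then have "snd p \<in> R" by (simp add: extends_def)
    then obtain D' x' where e2: "extends R E (snd p) D' x'" "cylinder R D' x' \<inter> N n = {}"
      using N(1)[of n] fin unfolding nwd_def by blast
    have "E \<subseteq> D'" using e2(1) by (simp add: extends_def)
    then have "S n p (D', x')" using e2 extends_trans[OF e1 e2(1)] by (auto simp: S_def E_def)
    then have "P (Suc n) (D', x')" using that extends_trans unfolding P_def S_def by blast
    with \<open>S n p (D', x')\<close> show ?thesis by blast
  qed
  ultimately obtain p where p: "\<And>n. P n (p n)" "\<And>n. S n (p n) (p (Suc n))"
    using dependent_nat_choice[of P S] by blast
  have chain: "extends R (fst (p m)) (snd (p m)) (fst (p n)) (snd (p n))" if "m \<le> n" for m n
    using that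
  proof (induction n rule: dec_induct)
    case base
    then show ?case using p(1)[of m] by (auto simp: P_def extends_def)
  next
    case (step n)
    then show ?case using p(2)[of n] extends_trans by (metis S_def)
  qed
  define y where "y = (\<lambda>i. snd (p (Suc (to_nat i))) i)"
  have y: "y i = snd (p n) i" if "i \<in> fst (p n)" for i n
  proof -
    have "i \<in> fst (p (Suc (to_nat i)))" using p(2)[of "to_nat i"] by (simp add: S_def)
    with that chain[of n "Suc (to_nat i)"] chain[of "Suc (to_nat i)" n] show ?thesis
      unfolding y_def extends_def by (metis nle_le)
  qed
  have yR: "y \<in> R"
  proof -
    have "\<exists>z\<in>R. \<forall>i\<in>F. z i = y i" if F: "finite F" for F
    proof -
      obtain n where n: "\<And>i. i \<in> F \<Longrightarrow> to_nat i < n"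
        using F finite_nat_set_iff_bounded[of "to_nat ` F"] by auto
      have "F \<subseteq> fst (p n)"
      proof
        fix i assume "i \<in> F"
        then have "Suc (to_nat i) \<le> n" using n by (simp add: Suc_leI)
        then show "i \<in> fst (p n)"
          using chain[of "Suc (to_nat i)" n] p(2)[of "to_nat i"] by (auto simp: S_def extends_def)
      qed
      then show ?thesis using y p(1)[of n] unfolding P_def extends_def by (metis subsetD)
    qed
    then show ?thesis using R unfolding pointwise_closed_def by blast
  qed
  have incyl: "y \<in> cylinder R (fst (p n)) (snd (p n))" for n
    using yR y by (auto simp: cylinder_def)
  then have "y \<in> cylinder R D x" using p(1)[of 0] cylinder_mono unfolding P_def by blast
  then obtain n where "y \<in> N n" using N(2) by blast
  with incyl[of "Suc n"] p(2)[of n] show False by (auto simp: S_def)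
qed

text \<open>There are only countably many cylinders, so \<open>A\<close> is meagre on the union of
  those where it is meagre; by \<open>loc\<close>, what this union leaves of the given cylinder is
  nowhere dense.\<close>

theorem banach_category:
  fixes R :: "('i::countable \<Rightarrow> 'b::countable) set"
  assumes D: "finite D"
    and loc: "\<And>D' x'. extends R D x D' x' \<Longrightarrow>
      \<exists>D'' x''. extends R D' x' D'' x'' \<and> meagre R (A \<inter> cylinder R D'' x'')"
  shows "meagre R (A \<inter> cylinder R D x)"
proof -
  define Cs where "Cs = {C. (\<exists>E y. finite E \<and> C = cylinder R E y) \<and> meagre R (A \<inter> C)}"
  have "Cs \<subseteq> (\<lambda>P. {y \<in> R. \<forall>(i, b)\<in>P. y i = b}) ` {P. finite P}"
  proof
    fix C assume "C \<in> Cs"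
    then obtain E y where E: "finite E" "C = cylinder R E y" by (auto simp: Cs_def)
    then have "C = {z \<in> R. \<forall>(i, b)\<in>(\<lambda>i. (i, y i)) ` E. z i = b}" by (auto simp: cylinder_def)
    with E(1) show "C \<in> (\<lambda>P. {y \<in> R. \<forall>(i, b)\<in>P. y i = b}) ` {P. finite P}" by blast
  qed
  then have "countable Cs"
    using countable_Collect_finite by (meson countable_image countable_subset)
  then have 1: "meagre R (\<Union>C\<in>Cs. A \<inter> C)"
    by (rule meagre_UN_countable) (simp add: Cs_def)
  have 2: "nwd R (cylinder R D x - \<Union>Cs)"
    unfolding nwd_def
  proof (intro allI impI)
    fix E :: "'i set" and y assume E: "finite E" and y: "y \<in> R"
    have e: "extends R E y (E \<union> D) y" using E D y by (auto simp: extends_def)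
    show "\<exists>D' x'. extends R E y D' x' \<and> cylinder R D' x' \<inter> (cylinder R D x - \<Union>Cs) = {}"
    proof (cases "\<forall>i\<in>D. y i = x i")
      case True
      then have "extends R D x (E \<union> D) y" using E D y by (auto simp: extends_def)
      then obtain D'' x'' where "extends R (E \<union> D) y D'' x''" "meagre R (A \<inter> cylinder R D'' x'')"
        using loc by blast
      moreover from this have "cylinder R D'' x'' \<in> Cs" by (auto simp: Cs_def extends_def)
      ultimately show ?thesis using extends_trans[OF e] by blast
    next
      case False
      then have "cylinder R (E \<union> D) y \<inter> cylinder R D x = {}" by (auto simp: cylinder_def)
      then show ?thesis using e by blast
    qed
  qed
  show ?thesis
    by (rule meagre_subset[OF meagre_Un[OF 1 nwd_imp_meagre[OF 2]]]) auto
qed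

lemma big_extends: "big R D x A \<Longrightarrow> extends R D x D' x' \<Longrightarrow> big R D' x' A"
  unfolding big_def using extends_trans by blast

lemma ex_big:
  fixes R :: "('i::countable \<Rightarrow> 'b::countable) set"
  assumes "finite D" "\<not> meagre R (A \<inter> cylinder R D x)"
  shows "\<exists>D' x'. extends R D x D' x' \<and> big R D' x' A"
  using banach_category[OF assms(1)] assms(2) unfolding big_def by metis

lemma big_UN:
  fixes R :: "('i::countable \<Rightarrow> 'b::countable) set" and A :: "nat \<Rightarrow> _"
  assumes "finite D" "x \<in> R" "big R D x (\<Union>n. A n)"
  shows "\<exists>n D' x'. extends R D x D' x' \<and> big R D' x' (A n)"
proof -
  have "\<not> meagre R (\<Union>n. A n \<inter> cylinder R D x)"
    using assms(3) extends_refl[OF assms(1,2)] unfolding big_def by simp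
  then obtain n where "\<not> meagre R (A n \<inter> cylinder R D x)"
    using meagre_UN[of R "\<lambda>n. A n \<inter> cylinder R D x"] by blast
  then show ?thesis using ex_big[OF assms(1)] by blast
qed

text \<open>The Baire property, in the form that every condition has an extension deciding \<open>B\<close>.\<close>
definition BP :: "('i \<Rightarrow> 'b) set \<Rightarrow> bool" where
  "BP B \<longleftrightarrow> (\<forall>D x. finite D \<longrightarrow> (\<exists>D' x'. extends UNIV D x D' x' \<and>
     (meagre UNIV (cylinder UNIV D' x' - B) \<or> meagre UNIV (cylinder UNIV D' x' \<inter> B))))"

lemma BP_compl: "BP B \<Longrightarrow> BP (UNIV - B)"
proof -
  have "cylinder UNIV D x - (UNIV - B) = cylinder UNIV D x \<inter> B"
    "cylinder UNIV D x \<inter> (UNIV - B) = cylinder UNIV D x - B" for D and x :: "'a \<Rightarrow> 'b" by auto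
  moreover assume "BP B"
  ultimately show ?thesis unfolding BP_def by metis
qed

text \<open>Extend first to a condition where \<open>B\<close> is big; below it the second
  alternative in \<open>BP\<close> is impossible.\<close>

lemma BP_nonmeagre:
  fixes B :: "('i::countable \<Rightarrow> 'b::countable) set"
  assumes "BP B" "finite D" "\<not> meagre UNIV (B \<inter> cylinder UNIV D x)"
  shows "\<exists>D' x'. extends UNIV D x D' x' \<and> meagre UNIV (cylinder UNIV D' x' - B)"
proof -
  obtain D1 x1 where 1: "extends UNIV D x D1 x1" "big UNIV D1 x1 B" using ex_big[OF assms(2,3)] by blast
  then have "finite D1" by (simp add: extends_def)
  then obtain D2 x2 where 2: "extends UNIV D1 x1 D2 x2"
     "meagre UNIV (cylinder UNIV D2 x2 - B) \<or> meagre UNIV (cylinder UNIV D2 x2 \<inter> B)"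
    using assms(1) unfolding BP_def by blast
  then show ?thesis using 1 extends_trans[OF 1(1) 2(1)] unfolding big_def by (metis inf.commute)
qed

lemma BP_UN:
  fixes B :: "nat \<Rightarrow> ('i::countable \<Rightarrow> 'b::countable) set"
  assumes "\<And>n. BP (B n)" shows "BP (\<Union>n. B n)"
  unfolding BP_def
proof (intro allI impI)
  fix D :: "'i set" and x :: "'i \<Rightarrow> 'b" assume D: "finite D"
  show "\<exists>D' x'. extends UNIV D x D' x' \<and>
    (meagre UNIV (cylinder UNIV D' x' - (\<Union>n. B n)) \<or> meagre UNIV (cylinder UNIV D' x' \<inter> (\<Union>n. B n)))"
  proof (cases "\<exists>n. \<not> meagre UNIV (B n \<inter> cylinder UNIV D x)")
    case True
    then obtain n D' x' where "extends UNIV D x D' x'" "meagre UNIV (cylinder UNIV D' x' - B n)"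
      using BP_nonmeagre[OF assms D] by blast
    moreover have "cylinder UNIV D' x' - (\<Union>n. B n) \<subseteq> cylinder UNIV D' x' - B n" by blast
    ultimately show ?thesis using meagre_subset by blast
  next
    case False
    then have "meagre UNIV (\<Union>n. B n \<inter> cylinder UNIV D x)" by (intro meagre_UN) auto
    then have "meagre UNIV (cylinder UNIV D x \<inter> (\<Union>n. B n))" by (simp add: Int_commute)
    then show ?thesis using extends_refl[OF D UNIV_I] by blast
  qed
qed

lemma BP_coordinate:
  fixes P :: "'b \<Rightarrow> bool" and i :: 'i
  shows "BP {z :: 'i \<Rightarrow> 'b. P (z i)}"
  unfolding BP_def
proof (intro allI impI)
  fix D :: "'i set" and x :: "'i \<Rightarrow> 'b" assume D: "finite D"
  have "extends UNIV D x (insert i D) x" using D by (auto simp: extends_def)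
  moreover have "cylinder UNIV (insert i D) x - {z. P (z i)} = {} \<or>
      cylinder UNIV (insert i D) x \<inter> {z. P (z i)} = {}" by (auto simp: cylinder_def)
  ultimately show "\<exists>D' x'. extends UNIV D x D' x' \<and>
     (meagre UNIV (cylinder UNIV D' x' - {z. P (z i)}) \<or> meagre UNIV (cylinder UNIV D' x' \<inter> {z. P (z i)}))"
    using meagre_empty by metis
qed

lemma sigma_algebra_BP: "sigma_algebra UNIV {B :: ('i::countable \<Rightarrow> 'b::countable) set. BP B}"
proof (rule sigma_algebra_iff2[THEN iffD2], intro conjI ballI allI impI)
  have "BP ({} :: ('i \<Rightarrow> 'b) set)" using BP_coordinate[of "\<lambda>_. False"] by simp
  then show "{} \<in> {B :: ('i \<Rightarrow> 'b) set. BP B}" by simp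
next
  fix B :: "('i \<Rightarrow> 'b) set" assume "B \<in> {B. BP B}"
  then show "UNIV - B \<in> {B. BP B}" using BP_compl by blast
next
  fix A :: "nat \<Rightarrow> ('i \<Rightarrow> 'b) set" assume "range A \<subseteq> {B. BP B}"
  then show "(\<Union>i. A i) \<in> {B. BP B}" using BP_UN[of A] by blast
qed simp

section \<open>Functions measurable with respect to the Baire property\<close>

definition BP_measurable :: "(('i \<Rightarrow> 'b) \<Rightarrow> 'a::topological_space) \<Rightarrow> bool" where
  "BP_measurable u \<longleftrightarrow> (\<forall>V. open V \<longrightarrow> BP {z. u z \<in> V})"

text \<open>A diameter bound \<open>1 / n\<close> in product form, so that every set qualifies for
  \<open>n = 0\<close>; the construction starts with the whole space.\<close>

definition small :: "nat \<Rightarrow> 'a::metric_space set \<Rightarrow> bool" where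
  "small n V \<longleftrightarrow> (\<forall>x\<in>V. \<forall>y\<in>V. real n * dist x y \<le> 1)"

text \<open>Countably many small balls around a dense set cover the space, so the preimage of one of
  them is nonmeagre in the cylinder, and the Baire property makes it comeagre further down.\<close>

lemma BP_measurable_decide:
  fixes u :: "('i::countable \<Rightarrow> 'b::countable) \<Rightarrow> 'a::polish_space"
  assumes u: "BP_measurable u" and D: "finite D"
  shows "\<exists>D' x' V. extends UNIV D x D' x' \<and> small n V \<and> meagre UNIV (cylinder UNIV D' x' - {z. u z \<in> V})"
proof -
  obtain d :: "nat \<Rightarrow> 'a" where d: "\<And>U. open U \<Longrightarrow> U \<noteq> {} \<Longrightarrow> \<exists>i. d i \<in> U"
  proof -
    obtain E :: "'a set" where E: "countable E" "\<And>X. open X \<Longrightarrow> X \<noteq> {} \<Longrightarrow> \<exists>d\<in>E. d \<in> X"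
      using countable_dense_setE by blast
    have "E \<noteq> {}" using E(2)[of UNIV] by auto
    then show ?thesis using that[of "from_nat_into E"] E by (metis from_nat_into_surj)
  qed
  define r where "r = 1 / (2 * (real n + 1))"
  have r: "r > 0" by (simp add: r_def)
  have "UNIV = (\<Union>i. ball (d i) r)"
  proof -
    have "\<exists>i. y \<in> ball (d i) r" for y
      using d[of "ball y r"] r by (auto simp: dist_commute)
    then show ?thesis by blast
  qed
  then have "cylinder UNIV D x = (\<Union>i. {z. u z \<in> ball (d i) r} \<inter> cylinder UNIV D x)" by blast
  moreover have "\<not> meagre UNIV (cylinder UNIV D x)"
    by (rule not_meagre_cylinder) (auto simp: D pointwise_closed_def)
  ultimately obtain i where "\<not> meagre UNIV ({z. u z \<in> ball (d i) r} \<inter> cylinder UNIV D x)"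
    using meagre_UN by metis
  moreover have "BP {z. u z \<in> ball (d i) r}" using u unfolding BP_measurable_def by blast
  ultimately obtain D' x' where "extends UNIV D x D' x'"
    "meagre UNIV (cylinder UNIV D' x' - {z. u z \<in> ball (d i) r})"
    using BP_nonmeagre[OF _ D] by blast
  moreover have "small n (ball (d i) r)"
    unfolding small_def
  proof (intro ballI)
    fix a b assume "a \<in> ball (d i) r" "b \<in> ball (d i) r"
    then have "dist a b \<le> 2 * r" using dist_triangle[of a b "d i"] by (simp add: dist_commute)
    then have "real n * dist a b \<le> real n * (2 * r)" by (intro mult_left_mono) auto
    also have "\<dots> \<le> 1" by (simp add: r_def field_simps)
    finally show "real n * dist a b \<le> 1" .
  qed
  ultimately show ?thesis by blast
qed

subsection \<open>Pairs of leaf labellings\<close>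

text \<open>A strategy names, at each node, the finitely many children it gives up; a node is dropped when
  the path to it passes through a child given up. So a condition in \<open>pairs T\<close> is a pair of leaf
  labellings with a certificate that they differ modulo the iterated Frechet ideal of \<open>T\<close>, whose leaves
  are the lists outside \<open>T\<close>.\<close>
definition dropped :: "(nat list \<Rightarrow> nat) \<Rightarrow> nat list \<Rightarrow> bool" where
  "dropped \<sigma> t \<longleftrightarrow> (\<exists>k<length t. t ! k < \<sigma> (take k t))"

type_synonym cond = "nat list \<Rightarrow> bool \<times> bool \<times> nat"

abbreviation lft :: "cond \<Rightarrow> nat list \<Rightarrow> bool" where "lft x \<equiv> \<lambda>t. fst (x t)"
abbreviation rgt :: "cond \<Rightarrow> nat list \<Rightarrow> bool" where "rgt x \<equiv> \<lambda>t. fst (snd (x t))"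
abbreviation strat :: "cond \<Rightarrow> nat list \<Rightarrow> nat" where "strat x \<equiv> \<lambda>t. snd (snd (x t))"

definition pairs :: "nat list set \<Rightarrow> cond set" where
  "pairs T = {x. \<forall>t. t \<notin> T \<longrightarrow> \<not> dropped (strat x) t \<longrightarrow> lft x t \<noteq> rgt x t}"

lemma dropped_cong: "(\<And>k. k < length t \<Longrightarrow> \<sigma> (take k t) = \<tau> (take k t)) \<Longrightarrow> dropped \<sigma> t = dropped \<tau> t"
  by (auto simp: dropped_def)

lemma dropped_take: "dropped \<sigma> (take k t) \<Longrightarrow> dropped \<sigma> t"
  unfolding dropped_def by (metis append_take_drop_id length_take min_less_iff_conj nth_take take_take min.absorb3)

text \<open>The constraint at \<open>t\<close> reads only the coordinates \<open>t\<close> and its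
  proper prefixes. Carrying the strategy inside the point is what makes it so local.\<close>

lemma pointwise_closed_pairs: "pointwise_closed (pairs T)"
  unfolding pointwise_closed_def
proof (intro allI impI)
  fix x :: cond assume x: "\<forall>D. finite D \<longrightarrow> (\<exists>y\<in>pairs T. \<forall>i\<in>D. y i = x i)"
  have "lft x t \<noteq> rgt x t" if t: "t \<notin> T" "\<not> dropped (strat x) t" for t
  proof -
    have "finite (insert t ((\<lambda>k. take k t) ` {..<length t}))" by simp
    then obtain y where "y \<in> pairs T" "y t = x t" "\<And>k. k < length t \<Longrightarrow> y (take k t) = x (take k t)"
      using x[rule_format, of "insert t ((\<lambda>k. take k t) ` {..<length t})"] by auto
    moreover from this have "dropped (strat y) t = dropped (strat x) t"
      by (intro dropped_cong) simp
    ultimately show ?thesis using t by (auto simp: pairs_def)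
  qed
  then show "x \<in> pairs T" by (simp add: pairs_def)
qed

text \<open>Keep the strategy and, off \<open>D\<close>, let the right label be the negation of the
  new left one: constraints off \<open>D\<close> are met and those on \<open>D\<close> are
  unchanged.\<close>

lemma extends_lft:
  assumes "extends UNIV D (lft x) D' z" "x \<in> pairs T"
  shows "\<exists>x'. extends (pairs T) D x D' x' \<and> lft x' = z"
proof -
  define x' where "x' = (\<lambda>t. (z t, if t \<in> D then rgt x t else \<not> z t, strat x t))"
  have "extends (pairs T) D x D' x'"
    using assms by (auto simp: extends_def x'_def pairs_def)
  then show ?thesis by (auto simp: x'_def)
qed

lemma extends_rgt:
  assumes "extends UNIV D (rgt x) D' z" "x \<in> pairs T"
  shows "\<exists>x'. extends (pairs T) D x D' x' \<and> rgt x' = z"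
proof -
  define x' where "x' = (\<lambda>t. (if t \<in> D then lft x t else \<not> z t, z t, strat x t))"
  have "extends (pairs T) D x D' x'"
    using assms by (auto simp: extends_def x'_def pairs_def)
  then show ?thesis by (auto simp: x'_def)
qed

text \<open>The hypothesis \<open>lift\<close> is openness of \<open>p\<close> at the level of
  conditions, so a condition avoiding a nowhere dense set lifts to one avoiding its
  preimage.\<close>

lemma meagre_vimage:
  fixes p :: "('i \<Rightarrow> 'b) \<Rightarrow> 'i \<Rightarrow> 'c"
  assumes lift: "\<And>D x D' z. extends UNIV D (p x) D' z \<Longrightarrow> x \<in> R \<Longrightarrow> \<exists>x'. extends R D x D' x' \<and> p x' = z"
    and p: "\<And>D x y. y \<in> cylinder R D x \<Longrightarrow> p y \<in> cylinder UNIV D (p x)"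
    and M: "meagre UNIV M"
  shows "meagre R (R \<inter> p -` M)"
proof -
  obtain N where N: "\<And>n::nat. nwd UNIV (N n)" "M \<subseteq> (\<Union>n. N n)" using M unfolding meagre_def by blast
  have "nwd R (R \<inter> p -` N n)" for n
    unfolding nwd_def
  proof (intro allI impI)
    fix D :: "'i set" and x assume D: "finite D" and x: "x \<in> R"
    obtain D' z where z: "extends UNIV D (p x) D' z" "cylinder UNIV D' z \<inter> N n = {}"
      using N(1)[of n] D unfolding nwd_def by blast
    obtain x' where x': "extends R D x D' x'" "p x' = z" using lift[OF z(1) x] by blast
    have "cylinder R D' x' \<inter> (R \<inter> p -` N n) = {}" using p[of _ D' x'] x'(2) z(2) by blast
    then show "\<exists>D' x'. extends R D x D' x' \<and> cylinder R D' x' \<inter> (R \<inter> p -` N n) = {}"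
      using x'(1) by blast
  qed
  moreover have "R \<inter> p -` M \<subseteq> (\<Union>n. R \<inter> p -` N n)" using N(2) by blast
  ultimately show ?thesis unfolding meagre_def by (intro exI[of _ "\<lambda>n. R \<inter> p -` N n"]) blast
qed

lemma meagre_lft: "meagre UNIV M \<Longrightarrow> meagre (pairs T) (pairs T \<inter> lft -` M)"
  by (rule meagre_vimage) (use extends_lft in \<open>auto simp: cylinder_def\<close>)

lemma meagre_rgt: "meagre UNIV M \<Longrightarrow> meagre (pairs T) (pairs T \<inter> rgt -` M)"
  by (rule meagre_vimage) (use extends_rgt in \<open>auto simp: cylinder_def\<close>)

section \<open>Finite codes and approximate triangles\<close>

text \<open>A single list codes initial segments of three points of the Baire space, interleaved modulo 3.\<close>
definition digits :: "nat \<Rightarrow> nat list \<Rightarrow> (nat \<Rightarrow> nat) set" where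
  "digits j s = {k. \<forall>i. j mod 3 + 3 * i < length s \<longrightarrow> k i = s ! (j mod 3 + 3 * i)}"

lemma digits_mod: "digits (j mod 3) s = digits j s"
  by (simp add: digits_def)

lemma digits_Nil: "digits j [] = UNIV"
  by (simp add: digits_def)

lemma digits_take: "digits j s \<subseteq> digits j (take n s)"
  by (auto simp: digits_def)

text \<open>Position \<open>length s\<close> holds digit \<open>length s div 3\<close> of the code
  numbered \<open>length s mod 3\<close>.\<close>

lemma digits_snoc:
  "digits j s \<inter> {k. k (length s div 3) = d} \<subseteq> digits j (s @ [d])"
proof
  fix k assume k: "k \<in> digits j s \<inter> {k. k (length s div 3) = d}"
  have "k i = (s @ [d]) ! (j mod 3 + 3 * i)" if "j mod 3 + 3 * i < Suc (length s)" for i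
  proof (cases "j mod 3 + 3 * i < length s")
    case True
    then show ?thesis using k by (simp add: digits_def nth_append)
  next
    case False
    with that have "length s = j mod 3 + 3 * i" by simp
    moreover from this have "length s div 3 = i" by simp
    ultimately show ?thesis using k by (simp add: nth_append)
  qed
  then show "k \<in> digits j (s @ [d])" by (simp add: digits_def)
qed

lemma digits_snoc_other:
  assumes "j mod 3 \<noteq> length s mod 3" shows "digits j (s @ [d]) = digits j s"
proof -
  have "j mod 3 + 3 * i \<noteq> length s" for i using assms by (metis mod_mod_trivial mod_mult_self2)
  then have "j mod 3 + 3 * i < Suc (length s) \<longleftrightarrow> j mod 3 + 3 * i < length s" for i
    by (simp add: less_Suc_eq)
  then show ?thesis by (simp add: digits_def nth_append cong: imp_cong)
qed

text \<open>In \<open>attempt\<close>, truncated subtraction makes the requirement void for \<open>length s \<le> 1\<close>.\<close>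
definition close :: "nat \<Rightarrow> 'a::metric_space \<times> 'a \<Rightarrow> 'a \<times> 'a \<Rightarrow> bool" where
  "close n p q \<longleftrightarrow> real n * dist (snd p) (fst q) \<le> 1"

definition attempt :: "((nat \<Rightarrow> nat) \<Rightarrow> 'a::metric_space \<times> 'a) \<Rightarrow> nat list \<Rightarrow> bool" where
  "attempt f s \<longleftrightarrow> (\<exists>k0\<in>digits 0 s. \<exists>k1\<in>digits 1 s. \<exists>k2\<in>digits 2 s.
     close (length s - 1) (f k0) (f k1) \<and> close (length s - 1) (f k1) (f k2) \<and>
     close (length s - 1) (f k2) (f k0))"

lemma close_mono: "close n p q \<Longrightarrow> m \<le> n \<Longrightarrow> close m p q"
  unfolding close_def by (meson mult_right_mono of_nat_le_iff order_trans zero_le_dist)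

lemma attempt_take: "attempt f s \<Longrightarrow> attempt f (take n s)"
proof -
  assume "attempt f s"
  then obtain k0 k1 k2 where "k0 \<in> digits 0 s" "k1 \<in> digits 1 s" "k2 \<in> digits 2 s"
     "close (length s - 1) (f k0) (f k1)" "close (length s - 1) (f k1) (f k2)"
     "close (length s - 1) (f k2) (f k0)" unfolding attempt_def by blast
  moreover have "length (take n s) - 1 \<le> length s - 1" by auto
  ultimately show ?thesis unfolding attempt_def
    by (intro bexI[of _ k0] bexI[of _ k1] bexI[of _ k2] conjI)
      (auto intro: close_mono subsetD[OF digits_take])
qed

text \<open>The three closeness requirements are cyclic, so the edges may be listed starting from
  any code number modulo 3.\<close>

lemma attempt_rotate:
  assumes "k \<in> digits n s" "l \<in> digits (n + 1) s" "m \<in> digits (n + 2) s"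
    "close (length s - 1) (f k) (f l)" "close (length s - 1) (f l) (f m)" "close (length s - 1) (f m) (f k)"
  shows "attempt f s"
proof -
  have "n mod 3 < 3" by simp
  then consider "n mod 3 = 0" | "n mod 3 = 1" | "n mod 3 = 2" by linarith
  then show ?thesis
  proof cases
    case 1
    then have "(n + 1) mod 3 = 1" "(n + 2) mod 3 = 2" by presburger+
    with 1 assms show ?thesis unfolding attempt_def by (metis digits_mod)
  next
    case 2
    then have "(n + 1) mod 3 = 2" "(n + 2) mod 3 = 0" by presburger+
    with 2 assms show ?thesis unfolding attempt_def by (metis digits_mod)
  next
    case 3
    then have "(n + 1) mod 3 = 0" "(n + 2) mod 3 = 1" by presburger+
    with 3 assms show ?thesis unfolding attempt_def by (metis digits_mod)
  qed
qed

lemma tendsto_digits: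
  assumes "\<And>n. k n \<in> digits j (map g [0..<n])"
  shows "k \<longlonglongrightarrow> (\<lambda>i. g (j mod 3 + 3 * i))"
proof -
  have "((\<lambda>n. k n i) \<longlongrightarrow> g (j mod 3 + 3 * i)) sequentially" for i
  proof -
  have "eventually (\<lambda>n. k n i = g (j mod 3 + 3 * i)) sequentially"
    unfolding eventually_sequentially
  proof (intro exI[of _ "Suc (j mod 3 + 3 * i)"] allI impI)
    fix n assume "Suc (j mod 3 + 3 * i) \<le> n"
    then show "k n i = g (j mod 3 + 3 * i)" using assms[of n] by (simp add: digits_def)
  qed
  then show ?thesis by (rule tendsto_eventually)
  qed
  then have "limitin (product_topology (\<lambda>_. euclidean) UNIV) k (\<lambda>i. g (j mod 3 + 3 * i)) sequentially"
    by (simp add: limitin_componentwise)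
  then show ?thesis by (simp only: euclidean_product_topology limitin_canonical_iff)
qed

lemma close_limit:
  fixes p q :: "nat \<Rightarrow> 'a::metric_space \<times> 'a"
  assumes "p \<longlonglongrightarrow> a" "q \<longlonglongrightarrow> b" "\<And>n. close (n - 1) (p n) (q n)"
  shows "snd a = fst b"
proof -
  have lim: "(\<lambda>n. dist (snd (p n)) (fst (q n))) \<longlonglongrightarrow> dist (snd a) (fst b)"
    using assms(1,2) by (intro tendsto_intros)
  have "(\<lambda>n. 1 / real n) \<longlonglongrightarrow> 0" by (rule lim_1_over_n)
  then have "(\<lambda>n. 1 / real (n - 1)) \<longlonglongrightarrow> 0"
    using LIMSEQ_imp_Suc[of "\<lambda>n. 1 / real (n - 1)" 0] by simp
  moreover have "\<exists>N. \<forall>n\<ge>N. dist (snd (p n)) (fst (q n)) \<le> 1 / real (n - 1)"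
  proof (intro exI[of _ 2] allI impI)
    fix n :: nat assume "2 \<le> n"
    then show "dist (snd (p n)) (fst (q n)) \<le> 1 / real (n - 1)"
      using assms(3)[of n] unfolding close_def by (simp add: field_simps)
  qed
  ultimately have "dist (snd a) (fst b) \<le> 0" using lim by (rule LIMSEQ_le[rotated])
  then show ?thesis by simp
qed

text \<open>The codes witnessing \<open>attempt f\<close> along the branch converge digit by digit;
  by continuity the near matches of endpoints become equalities in the limit.\<close>

lemma attempt_branch_triangle:
  fixes f :: "(nat \<Rightarrow> nat) \<Rightarrow> 'a::metric_space \<times> 'a"
  assumes f: "continuous_on UNIV f" and g: "\<And>n. attempt f (map g [0..<n])" and "sym (range f)"
  shows "\<not> triangle_free (range f)"
proof -
  obtain k0 k1 k2 where k: "\<And>n. k0 n \<in> digits 0 (map g [0..<n])" "\<And>n. k1 n \<in> digits 1 (map g [0..<n])"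
     "\<And>n. k2 n \<in> digits 2 (map g [0..<n])"
    and c: "\<And>n. close (n - 1) (f (k0 n)) (f (k1 n))" "\<And>n. close (n - 1) (f (k1 n)) (f (k2 n))"
     "\<And>n. close (n - 1) (f (k2 n)) (f (k0 n))"
  proof -
    have "\<forall>n. \<exists>k. fst k \<in> digits 0 (map g [0..<n]) \<and> fst (snd k) \<in> digits 1 (map g [0..<n]) \<and>
        snd (snd k) \<in> digits 2 (map g [0..<n]) \<and> close (n - 1) (f (fst k)) (f (fst (snd k))) \<and>
        close (n - 1) (f (fst (snd k))) (f (snd (snd k))) \<and> close (n - 1) (f (snd (snd k))) (f (fst k))"
      using g unfolding attempt_def by fastforce
    then obtain k where "\<forall>n. fst (k n) \<in> digits 0 (map g [0..<n]) \<and> fst (snd (k n)) \<in> digits 1 (map g [0..<n]) \<and>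
        snd (snd (k n)) \<in> digits 2 (map g [0..<n]) \<and> close (n - 1) (f (fst (k n))) (f (fst (snd (k n)))) \<and>
        close (n - 1) (f (fst (snd (k n)))) (f (snd (snd (k n)))) \<and> close (n - 1) (f (snd (snd (k n)))) (f (fst (k n)))"
      by (rule choice[THEN exE])
    then show ?thesis
      by (intro that[of "\<lambda>n. fst (k n)" "\<lambda>n. fst (snd (k n))" "\<lambda>n. snd (snd (k n))"]) simp_all
  qed
  define l where "l = (\<lambda>j i. g (j mod 3 + 3 * i))"
  have lim: "(\<lambda>n. f (k n)) \<longlonglongrightarrow> f (l j)" if "\<And>n. k n \<in> digits j (map g [0..<n])" for k j
  proof -
    have "k \<longlonglongrightarrow> l j" unfolding l_def by (rule tendsto_digits[OF that])
    then show ?thesis using continuous_on_tendsto_compose[OF f] by simp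
  qed
  have e: "snd (f (l 0)) = fst (f (l 1))" "snd (f (l 1)) = fst (f (l 2))" "snd (f (l 2)) = fst (f (l 0))"
    using close_limit[OF lim[OF k(1)] lim[OF k(2)] c(1)] close_limit[OF lim[OF k(2)] lim[OF k(3)] c(2)]
      close_limit[OF lim[OF k(3)] lim[OF k(1)] c(3)] by auto
  have "(fst (f (l j)), snd (f (l j))) \<in> range f" for j by simp
  \<comment> \<open>Symmetry reverses the last edge of the directed cycle, as
    \<open>triangle_free\<close> is stated with \<open>(x, z)\<close>.\<close>
  then have "(fst (f (l 0)), fst (f (l 1))) \<in> range f" "(fst (f (l 1)), fst (f (l 2))) \<in> range f"
    "(fst (f (l 0)), fst (f (l 2))) \<in> range f"
    using e \<open>sym (range f)\<close> by (metis symD)+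
  then show ?thesis unfolding triangle_free_def by blast
qed

text \<open>The bound \<open>b\<close> makes the tree finitely branching, so a node with extensions
  of every length has a child with the same property.\<close>

lemma koenig_bounded:
  fixes Q :: "nat list \<Rightarrow> bool"
  assumes take: "\<And>s n. Q s \<Longrightarrow> Q (take n s)"
    and ex: "\<And>n. \<exists>s. Q s \<and> length s = n \<and> (\<forall>j<n. s ! j \<le> b j)"
  shows "\<exists>g. \<forall>n. Q (map g [0..<n])"
proof -
  define E where "E = (\<lambda>s. \<forall>n\<ge>length s. \<exists>s'. Q s' \<and> length s' = n \<and> take (length s) s' = s \<and> (\<forall>j<n. s' ! j \<le> b j))"
  have E0: "E []" using ex by (simp add: E_def)
  have step: "\<exists>d. E (s @ [d])" if "E s" for s
  proof (rule ccontr)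
    assume "\<not> ?thesis"
    then have "\<forall>d. \<exists>n. n \<ge> Suc (length s) \<and> \<not> (\<exists>s'. Q s' \<and> length s' = n \<and> take (Suc (length s)) s' = s @ [d] \<and> (\<forall>j<n. s' ! j \<le> b j))"
      by (simp add: E_def)
    then obtain N where N: "\<And>d. N d \<ge> Suc (length s)"
      "\<And>d s'. Q s' \<Longrightarrow> length s' = N d \<Longrightarrow> take (Suc (length s)) s' = s @ [d] \<Longrightarrow> \<exists>j<N d. \<not> s' ! j \<le> b j"
      by metis
    \<comment> \<open>This \<open>n\<close> dominates the failing length \<open>N d\<close> of every
      admissible next entry \<open>d\<close>, so an extension of length \<open>n\<close> refutes the
      choice of \<open>N\<close> at its own next entry.\<close>
    define n where "n = Suc (length s) + (\<Sum>d\<le>b (length s). N d)"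
    obtain s' where s': "Q s'" "length s' = n" "take (length s) s' = s" "\<And>j. j < n \<Longrightarrow> s' ! j \<le> b j"
      using \<open>E s\<close> unfolding E_def n_def by (metis le_add1 le_Suc_eq add_Suc)
    define d where "d = s' ! length s"
    have dn: "length s < n" by (simp add: n_def)
    then have "d \<le> b (length s)" using s'(4) by (simp add: d_def)
    then have Nn: "N d \<le> n" unfolding n_def using member_le_sum[of d "{..b (length s)}" N] by simp
    have "take (Suc (length s)) s' = s @ [d]"
      using s' dn by (simp add: take_Suc_conv_app_nth d_def)
    then have "take (Suc (length s)) (take (N d) s') = s @ [d]" using N(1)[of d] by (simp add: min_def)
    then have "\<exists>j<N d. \<not> take (N d) s' ! j \<le> b j"
      by (intro N(2)) (use s' Nn take in auto)
    then show False using s'(4) Nn by auto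
  qed
  obtain c where c: "\<And>s. E s \<Longrightarrow> E (s @ [c s])" using step by metis
  define w where "w = rec_nat [] (\<lambda>_ s. s @ [c s])"
  have w: "w 0 = []" "w (Suc n) = w n @ [c (w n)]" for n by (simp_all add: w_def)
  have "E (w n)" for n by (induction n) (simp_all add: w E0 c)
  moreover have "w n = map (\<lambda>i. c (w i)) [0..<n]" for n by (induction n) (simp_all add: w)
  moreover have "Q s" if "E s" for s using that unfolding E_def by (metis order_refl take_all)
  ultimately show ?thesis by metis
qed

subsection \<open>The generic triangle\<close>

definition edges where
  "edges f u T K = {x \<in> pairs T. \<exists>k\<in>K. f k = (u (lft x), u (rgt x))}"

definition comeagre_below :: "'i set \<Rightarrow> ('i \<Rightarrow> 'b) \<Rightarrow> ('i \<Rightarrow> 'b) set \<Rightarrow> bool" where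
  "comeagre_below D z B \<longleftrightarrow> meagre UNIV (cylinder UNIV D z - B)"

lemma comeagre_below_agree:
  "comeagre_below D z B \<Longrightarrow> D \<subseteq> D' \<Longrightarrow> (\<And>t. t \<in> D \<Longrightarrow> z' t = z t) \<Longrightarrow> comeagre_below D' z' B"
  unfolding comeagre_below_def by (erule meagre_subset) (auto simp: cylinder_def subset_iff)

text \<open>The pairs in the cylinder whose left vertex misses \<open>V\<close> or whose right
  vertex misses \<open>W\<close> form a meagre set, so a nonmeagre set of edges has a member outside
  it.\<close>

lemma big_edges_witness:
  assumes big: "big (pairs T) D x (edges f u T K)" and D: "finite D" and x: "x \<in> pairs T"
    and V: "comeagre_below D (lft x) {z. u z \<in> V}" and W: "comeagre_below D (rgt x) {z. u z \<in> W}"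
  shows "\<exists>k\<in>K. fst (f k) \<in> V \<and> snd (f k) \<in> W"
proof (rule ccontr)
  assume no: "\<not> ?thesis"
  let ?M = "cylinder UNIV D (lft x) - {z. u z \<in> V}" and ?N = "cylinder UNIV D (rgt x) - {z. u z \<in> W}"
  have "meagre (pairs T) (pairs T \<inter> lft -` ?M \<union> pairs T \<inter> rgt -` ?N)"
    using V W unfolding comeagre_below_def by (intro meagre_Un meagre_lft meagre_rgt)
  moreover have "edges f u T K \<inter> cylinder (pairs T) D x \<subseteq> pairs T \<inter> lft -` ?M \<union> pairs T \<inter> rgt -` ?N"
  proof
    fix y assume y: "y \<in> edges f u T K \<inter> cylinder (pairs T) D x"
    then have "u (lft y) \<notin> V \<or> u (rgt y) \<notin> W" using no by (force simp: edges_def)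
    then show "y \<in> pairs T \<inter> lft -` ?M \<union> pairs T \<inter> rgt -` ?N" using y by (auto simp: cylinder_def)
  qed
  ultimately have "meagre (pairs T) (edges f u T K \<inter> cylinder (pairs T) D x)" by (rule meagre_subset)
  then show False using big extends_refl[OF D x] unfolding big_def by blast
qed

definition two_of :: "bool \<Rightarrow> bool \<Rightarrow> bool \<Rightarrow> bool" where
  "two_of P Q R \<longleftrightarrow> P \<and> Q \<or> Q \<and> R \<or> R \<and> P"

text \<open>Three conditions for the edges of a would-be triangle, in cyclic order, with \<open>x\<close> the next one to
  be refined. The last clause controls the frontier of \<open>D\<close>: a frontier node that two of the three
  strategies drop carries at most one constraint, hence is harmless below; every other one lies above
  \<open>s\<close>, hence is an inner node of the tree.\<close>
definition invar where
  "invar f u T s D x y z \<longleftrightarrow>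
    finite D \<and> (\<forall>t\<in>D. \<forall>k. take k t \<in> D) \<and>
    x \<in> pairs T \<and> y \<in> pairs T \<and> z \<in> pairs T \<and>
    (\<forall>t\<in>D. rgt x t = lft y t \<and> rgt y t = lft z t \<and> rgt z t = lft x t) \<and>
    big (pairs T) D x (edges f u T (digits (length s) s)) \<and>
    big (pairs T) D y (edges f u T (digits (length s + 1) s)) \<and>
    big (pairs T) D z (edges f u T (digits (length s + 2) s)) \<and>
    (\<exists>V. small (length s) V \<and> comeagre_below D (lft x) {z. u z \<in> V}) \<and>
    (\<exists>V. small (length s - 1) V \<and> comeagre_below D (lft y) {z. u z \<in> V}) \<and>
    (\<exists>V. small (length s) V \<and> comeagre_below D (lft z) {z. u z \<in> V}) \<and>
    (\<forall>t. t \<notin> D \<longrightarrow> (\<forall>k<length t. take k t \<in> D) \<longrightarrow>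
       two_of (dropped (strat x) t) (dropped (strat y) t) (dropped (strat z) t) \<or>
       length t \<le> length s \<and> (\<forall>j<length t. s ! j \<le> t ! j))"

lemma small_mono: "small n V \<Longrightarrow> m \<le> n \<Longrightarrow> small m V"
  unfolding small_def by (meson mult_right_mono of_nat_le_iff order_trans zero_le_dist)

text \<open>Bigness gives an actual edge for each of the three conditions. Neighbouring edges end in
  a common small set because the labellings agree on \<open>D\<close>; this yields near matches
  only.\<close>

lemma invar_attempt:
  assumes "invar f u T s D x y z" shows "attempt f s"
proof -
  from assms have D: "finite D" and R: "x \<in> pairs T" "y \<in> pairs T" "z \<in> pairs T"
    and ag: "\<And>t. t \<in> D \<Longrightarrow> rgt x t = lft y t" "\<And>t. t \<in> D \<Longrightarrow> rgt y t = lft z t"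
      "\<And>t. t \<in> D \<Longrightarrow> rgt z t = lft x t"
    and B: "big (pairs T) D x (edges f u T (digits (length s) s))"
      "big (pairs T) D y (edges f u T (digits (length s + 1) s))"
      "big (pairs T) D z (edges f u T (digits (length s + 2) s))"
    and V: "\<exists>V. small (length s) V \<and> comeagre_below D (lft x) {z. u z \<in> V}"
      "\<exists>V. small (length s - 1) V \<and> comeagre_below D (lft y) {z. u z \<in> V}"
      "\<exists>V. small (length s) V \<and> comeagre_below D (lft z) {z. u z \<in> V}"
    unfolding invar_def by simp_all
  obtain V1 V2 V3 where V: "small (length s) V1" "comeagre_below D (lft x) {z. u z \<in> V1}"
    "small (length s - 1) V2" "comeagre_below D (lft y) {z. u z \<in> V2}"
    "small (length s) V3" "comeagre_below D (lft z) {z. u z \<in> V3}" using V by blast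
  have r: "comeagre_below D (rgt x) {z. u z \<in> V2}" "comeagre_below D (rgt y) {z. u z \<in> V3}"
    "comeagre_below D (rgt z) {z. u z \<in> V1}"
    using V(2,4,6) ag by (auto elim!: comeagre_below_agree)
  obtain k l m where "k \<in> digits (length s) s" "fst (f k) \<in> V1" "snd (f k) \<in> V2"
    "l \<in> digits (length s + 1) s" "fst (f l) \<in> V2" "snd (f l) \<in> V3"
    "m \<in> digits (length s + 2) s" "fst (f m) \<in> V3" "snd (f m) \<in> V1"
    using big_edges_witness[OF B(1) D R(1) V(2) r(1)] big_edges_witness[OF B(2) D R(2) V(4) r(2)]
      big_edges_witness[OF B(3) D R(3) V(6) r(3)] by blast
  moreover have "small (length s - 1) V1" "small (length s - 1) V3" using V(1,5) small_mono diff_le_self by blast+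
  ultimately show ?thesis using V(3)
    by (intro attempt_rotate[of k "length s" s l m]) (auto simp: small_def close_def)
qed

text \<open>Localise the left vertex, then the right one, then fix the next digit of the edge code,
  and finally close the domain under prefixes; each extension preserves the earlier
  decisions.\<close>

lemma refine_condition:
  fixes u :: "(nat list \<Rightarrow> bool) \<Rightarrow> 'a::polish_space"
  assumes u: "BP_measurable u" and D: "finite D" and x: "x \<in> pairs T"
    and big: "big (pairs T) D x (edges f u T (digits (length s) s))"
  shows "\<exists>D' x' d V W. extends (pairs T) D x D' x' \<and> (\<forall>t\<in>D'. \<forall>k. take k t \<in> D') \<and>
     big (pairs T) D' x' (edges f u T (digits (length s) (s @ [d]))) \<and>
     small n V \<and> comeagre_below D' (lft x') {z. u z \<in> V} \<and>
     small n W \<and> comeagre_below D' (rgt x') {z. u z \<in> W}"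
proof -
  obtain D1 x1 V where 1: "extends (pairs T) D x D1 x1" "small n V" "comeagre_below D1 (lft x1) {z. u z \<in> V}"
    using BP_measurable_decide[OF u D, of "lft x" n] extends_lft[OF _ x] unfolding comeagre_below_def by metis
  then have D1: "finite D1" and x1: "x1 \<in> pairs T" by (auto simp: extends_def)
  obtain D2 x2 W where 2: "extends (pairs T) D1 x1 D2 x2" "small n W" "comeagre_below D2 (rgt x2) {z. u z \<in> W}"
    using BP_measurable_decide[OF u D1, of "rgt x1" n] extends_rgt[OF _ x1] unfolding comeagre_below_def by metis
  then have D2: "finite D2" and x2: "x2 \<in> pairs T" by (auto simp: extends_def)
  have "edges f u T (digits (length s) s) \<subseteq> (\<Union>d. edges f u T (digits (length s) (s @ [d])))"
    using digits_snoc[of "length s" s] unfolding edges_def by blast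
  moreover have "big (pairs T) D2 x2 (edges f u T (digits (length s) s))"
    using big big_extends extends_trans 1(1) 2(1) by blast
  ultimately have "big (pairs T) D2 x2 (\<Union>d. edges f u T (digits (length s) (s @ [d])))"
    unfolding big_def by (meson Int_mono meagre_subset order_refl)
  then obtain d D3 x3 where 3: "extends (pairs T) D2 x2 D3 x3"
      "big (pairs T) D3 x3 (edges f u T (digits (length s) (s @ [d])))"
    using big_UN[OF D2 x2] by blast
  then have D3: "finite D3" and x3: "x3 \<in> pairs T" by (auto simp: extends_def)
  define D4 where "D4 = (\<lambda>(t, k). take k t) ` (SIGMA t:D3. {..length t})"
  have D4: "take k t \<in> D4" if "t \<in> D3" for t k
  proof -
    have "take k t = (\<lambda>(t, k). take k t) (t, min k (length t))" by (simp add: min_def)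
    moreover have "(t, min k (length t)) \<in> (SIGMA t:D3. {..length t})" using that by simp
    ultimately show ?thesis unfolding D4_def by (rule image_eqI)
  qed
  have "D3 \<subseteq> D4" using D4[of _ "length _"] by (metis order_refl subsetI take_all)
  then have 4: "extends (pairs T) D3 x3 D4 x3"
    using D3 x3 by (auto simp: extends_def D4_def)
  have cl: "\<forall>t\<in>D4. \<forall>k. take k t \<in> D4"
    using D4 by (auto simp: D4_def)
  note e24 = extends_trans[OF 3(1) 4] and e14 = extends_trans[OF 2(1) extends_trans[OF 3(1) 4]]
  have "comeagre_below D4 (lft x3) {z. u z \<in> V}"
    using e14 by (intro comeagre_below_agree[OF 1(3)]) (auto simp: extends_def)
  moreover have "comeagre_below D4 (rgt x3) {z. u z \<in> W}"
    using e24 by (intro comeagre_below_agree[OF 2(3)]) (auto simp: extends_def)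
  moreover have "big (pairs T) D4 x3 (edges f u T (digits (length s) (s @ [d])))"
    using 3(2) 4 by (rule big_extends)
  moreover have "extends (pairs T) D x D4 x3" using extends_trans[OF 1(1) e14] .
  ultimately show ?thesis using 1(2) 2(2) cl by blast
qed

lemma minimal_prefix:
  assumes "t \<notin> D"
  shows "\<exists>k\<le>length t. take k t \<notin> D \<and> (\<forall>i<k. take i t \<in> D)"
proof -
  define k where "k = (LEAST k. take k t \<notin> D)"
  have "take (length t) t \<notin> D" using assms by simp
  then have "take k t \<notin> D" "k \<le> length t" unfolding k_def by (rule LeastI, rule Least_le)
  moreover have "take i t \<in> D" if "i < k" for i using not_less_Least[OF that[unfolded k_def]] by simp
  ultimately show ?thesis by blast
qed

text \<open>Only \<open>x\<close> is extended generically; \<open>y\<close> and \<open>z\<close> are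
  then adapted to it on \<open>D'\<close>. The rotation to \<open>y'\<close>, \<open>z'\<close>,
  \<open>x'\<close> gives each edge code a new digit at every third step.\<close>

lemma invar_step:
  fixes u :: "(nat list \<Rightarrow> bool) \<Rightarrow> 'a::polish_space"
  assumes inv: "invar f u T s D x y z" and u: "BP_measurable u"
    and T: "\<And>t. length t \<le> length s \<Longrightarrow> (\<And>j. j < length t \<Longrightarrow> s ! j \<le> t ! j) \<Longrightarrow> t \<in> T"
  shows "\<exists>d D' x' y' z'. invar f u T (s @ [d]) D' y' z' x'"
proof -
  from inv have D: "finite D" and clD: "\<And>t k. t \<in> D \<Longrightarrow> take k t \<in> D"
    and R: "x \<in> pairs T" "y \<in> pairs T" "z \<in> pairs T"
    and ag: "\<And>t. t \<in> D \<Longrightarrow> rgt x t = lft y t" "\<And>t. t \<in> D \<Longrightarrow> rgt y t = lft z t"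
      "\<And>t. t \<in> D \<Longrightarrow> rgt z t = lft x t"
    and B: "big (pairs T) D x (edges f u T (digits (length s) s))"
      "big (pairs T) D y (edges f u T (digits (length s + 1) s))"
      "big (pairs T) D z (edges f u T (digits (length s + 2) s))"
    and V: "\<exists>V. small (length s) V \<and> comeagre_below D (lft z) {z. u z \<in> V}"
    and front: "\<And>t. t \<notin> D \<Longrightarrow> (\<And>k. k < length t \<Longrightarrow> take k t \<in> D) \<Longrightarrow>
       two_of (dropped (strat x) t) (dropped (strat y) t) (dropped (strat z) t) \<or>
       length t \<le> length s \<and> (\<forall>j<length t. s ! j \<le> t ! j)"
    unfolding invar_def by simp_all
  obtain D' x' d V1 V2 where e: "extends (pairs T) D x D' x'" and cl: "\<And>t k. t \<in> D' \<Longrightarrow> take k t \<in> D'"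
    and B1: "big (pairs T) D' x' (edges f u T (digits (length s) (s @ [d])))"
    and V1: "small (length s + 1) V1" "comeagre_below D' (lft x') {z. u z \<in> V1}"
    and V2: "small (length s + 1) V2" "comeagre_below D' (rgt x') {z. u z \<in> V2}"
    using refine_condition[OF u D R(1) B(1), of "length s + 1"] by blast
  from e have D': "finite D'" "D \<subseteq> D'" and x': "x' \<in> pairs T" and x'x: "\<And>t. t \<in> D \<Longrightarrow> x' t = x t"
    by (auto simp: extends_def)
  have "finite (\<Union>t\<in>insert (s @ [d]) D'. set t)" using D' by simp
  \<comment> \<open>As strategy value off \<open>D\<close>, this \<open>M\<close> drops every list
    of \<open>D'\<close> that continues past a node off \<open>D\<close>. Exceeding
    \<open>s @ [d]\<close> as well serves the new frontier.\<close>
  then obtain M where M: "\<And>t i. t \<in> D' \<Longrightarrow> i \<in> set t \<Longrightarrow> i < M" "\<And>i. i \<in> set (s @ [d]) \<Longrightarrow> i < M"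
    unfolding finite_nat_set_iff_bounded by auto
  define sy where "sy = (\<lambda>t. if t \<in> D then strat y t else M)"
  define sz where "sz = (\<lambda>t. if t \<in> D then strat z t else M)"
  text \<open>On the new part of \<open>D'\<close> at most one of the three strategies keeps a leaf alive, so
    the value of the third vertex can be chosen to satisfy the remaining constraint.\<close>
  define c where "c = (\<lambda>t. if dropped sz t then \<not> rgt x' t else \<not> lft x' t)"
  define y' :: cond where
    "y' = (\<lambda>t. if t \<in> D then y t else (rgt x' t, if t \<in> D' then c t else \<not> rgt x' t, M))"
  define z' :: cond where
    "z' = (\<lambda>t. if t \<in> D then z t else (if t \<in> D' then c t else \<not> lft x' t, lft x' t, M))"
  have st: "strat y' = sy" "strat z' = sz" by (auto simp: y'_def z'_def sy_def sz_def)
  define two where "two = (\<lambda>t. two_of (dropped (strat x') t) (dropped sy t) (dropped sz t))"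
  have two_take: "two t" if "two (take k t)" for t k
    using that dropped_take unfolding two_def two_of_def by blast
  \<comment> \<open>Dropping \<open>v\<close> depends on its proper prefixes only, and on
    \<open>D\<close> the strategies are unchanged.\<close>
  have front': "two v \<or> length v \<le> length s \<and> (\<forall>j<length v. s ! j \<le> v ! j)"
    if v: "v \<notin> D" "\<And>k. k < length v \<Longrightarrow> take k v \<in> D" for v
  proof -
    have "dropped (strat x') v = dropped (strat x) v" "dropped sy v = dropped (strat y) v"
      "dropped sz v = dropped (strat z) v"
      using v(2) x'x by (auto intro!: dropped_cong simp: sy_def sz_def)
    then show ?thesis using front[OF v] unfolding two_def by simp
  qed
  have dropM: "two t" if "k < length t" "take k t \<notin> D" "t ! k < M" for k t
  proof -
    have "dropped sy t" "dropped sz t" using that unfolding dropped_def sy_def sz_def by auto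
    then show ?thesis by (simp add: two_def two_of_def)
  qed
  \<comment> \<open>A new leaf leaves \<open>D\<close> at a node that is dropped twice or lies above
    \<open>s\<close>. In the second case that node is in \<open>T\<close>, so the leaf is strictly
    longer and both new strategies drop it.\<close>
  have new: "two t" if t: "t \<in> D'" "t \<notin> D" "t \<notin> T" for t
  proof -
    obtain k where k: "k \<le> length t" "take k t \<notin> D" "\<And>i. i < k \<Longrightarrow> take i t \<in> D"
      using minimal_prefix[OF t(2)] by blast
    have "two (take k t) \<or> length (take k t) \<le> length s \<and> (\<forall>j<length (take k t). s ! j \<le> take k t ! j)"
      by (rule front') (use k in simp_all)
    then show ?thesis
    proof
      assume "two (take k t)" then show ?thesis by (rule two_take)
    next
      assume "length (take k t) \<le> length s \<and> (\<forall>j<length (take k t). s ! j \<le> take k t ! j)"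
      then have "take k t \<in> T" using T by blast
      then have "k < length t" using k(1) t(3) by (cases "k = length t") auto
      moreover have "t ! k < M" using M(1)[OF t(1)] \<open>k < length t\<close> by simp
      ultimately show ?thesis using k(2) dropM by blast
    qed
  qed
  have y': "y' \<in> pairs T"
    unfolding pairs_def
  proof (intro CollectI allI impI)
    fix t assume t: "t \<notin> T" "\<not> dropped (strat y') t"
    show "lft y' t \<noteq> rgt y' t"
    proof (cases "t \<in> D")
      case True
      then have "dropped sy t = dropped (strat y) t" using clD by (intro dropped_cong) (simp add: sy_def)
      then show ?thesis using t st R(2) True by (auto simp: pairs_def y'_def)
    next
      case False
      \<comment> \<open>If \<open>y'\<close> keeps the leaf, then \<open>two\<close> forces
        \<open>z'\<close> to drop it, and in that case \<open>c\<close> serves the constraint of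
        \<open>y'\<close>.\<close>
      have "dropped sz t" if "t \<in> D'" using new[OF that False t(1)] t(2) st by (auto simp: two_def two_of_def)
      then show ?thesis using False by (auto simp: y'_def c_def)
    qed
  qed
  have z': "z' \<in> pairs T"
    unfolding pairs_def
  proof (intro CollectI allI impI)
    fix t assume t: "t \<notin> T" "\<not> dropped (strat z') t"
    show "lft z' t \<noteq> rgt z' t"
    proof (cases "t \<in> D")
      case True
      then have "dropped sz t = dropped (strat z) t" using clD by (intro dropped_cong) (simp add: sz_def)
      then show ?thesis using t st R(3) True by (auto simp: pairs_def z'_def)
    next
      case False
      then show ?thesis using t(2) st by (auto simp: z'_def c_def)
    qed
  qed
  have ey: "extends (pairs T) D y D' y'" and ez: "extends (pairs T) D z D' z'"
    using D' y' z' by (auto simp: extends_def y'_def z'_def)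
  have ag': "rgt x' t = lft y' t \<and> rgt y' t = lft z' t \<and> rgt z' t = lft x' t" if "t \<in> D'" for t
    using that ag x'x by (auto simp: y'_def z'_def)
  have By: "big (pairs T) D' y' (edges f u T (digits (length s + 1) (s @ [d])))"
  proof -
    have "(length s + 1) mod 3 \<noteq> length s mod 3" by presburger
    from digits_snoc_other[OF this] show ?thesis using big_extends[OF B(2) ey] by (rule ssubst)
  qed
  have Bz: "big (pairs T) D' z' (edges f u T (digits (length s + 2) (s @ [d])))"
  proof -
    have "(length s + 2) mod 3 \<noteq> length s mod 3" by presburger
    from digits_snoc_other[OF this] show ?thesis using big_extends[OF B(3) ez] by (rule ssubst)
  qed
  \<comment> \<open>Modulo 3 this is still the code \<open>length s\<close>, now indexed for the
    third place after the rotation.\<close>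
  have Bx: "big (pairs T) D' x' (edges f u T (digits (length s + 3) (s @ [d])))"
    using B1 by (simp add: digits_def)
  have Vy: "comeagre_below D' (lft y') {z. u z \<in> V2}"
    using ag' by (intro comeagre_below_agree[OF V2(2)]) auto
  obtain V3 where V3: "small (length s) V3" "comeagre_below D (lft z) {z. u z \<in> V3}" using V by blast
  have Vz: "comeagre_below D' (lft z') {z. u z \<in> V3}"
    using D'(2) by (intro comeagre_below_agree[OF V3(2)]) (auto simp: z'_def)
  \<comment> \<open>A frontier node not dropped twice leaves \<open>D\<close> above
    \<open>s\<close>. It goes on by at most one entry, since \<open>D'\<close> has no entry as large
    as \<open>M\<close>; that entry is at least \<open>M\<close>, so the node is above
    \<open>s @ [d]\<close>.\<close>
  have fr: "two t \<or> length t \<le> Suc (length s) \<and> (\<forall>j<length t. (s @ [d]) ! j \<le> t ! j)"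
    if t: "t \<notin> D'" "\<And>k. k < length t \<Longrightarrow> take k t \<in> D'" for t
  proof -
    have "t \<notin> D" using t(1) D'(2) by blast
    then obtain k where k: "k \<le> length t" "take k t \<notin> D" "\<And>i. i < k \<Longrightarrow> take i t \<in> D"
      using minimal_prefix by blast
    have "two (take k t) \<or> length (take k t) \<le> length s \<and> (\<forall>j<length (take k t). s ! j \<le> take k t ! j)"
      by (rule front') (use k in simp_all)
    then consider "two (take k t)" | "k \<le> length s" "\<And>j. j < k \<Longrightarrow> s ! j \<le> t ! j"
      using k(1) by (cases "two (take k t)") simp_all
    then show ?thesis
    proof cases
      case 2
      show ?thesis
      proof (cases "k < length t \<and> t ! k < M")
        case True
        then show ?thesis using dropM k(2) by blast
      next
        case False
        have "length t \<le> Suc k"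
        proof (rule ccontr)
          assume "\<not> ?thesis"
          then have l: "Suc k < length t" by simp
          have "t ! k \<in> set (take (Suc k) t)" using l by (simp add: take_Suc_conv_app_nth)
          then show False using M(1)[OF t(2)[OF l]] False l by auto
        qed
        moreover have "(s @ [d]) ! j \<le> t ! j" if "j < length t" for j
        proof (cases "j < k")
          case True
          then show ?thesis using 2 by (simp add: nth_append)
        next
          case j: False
          then have "j = k" using that \<open>length t \<le> Suc k\<close> by simp
          moreover have "(s @ [d]) ! k \<in> set (s @ [d])" using 2(1) by (intro nth_mem) simp
          ultimately show ?thesis using M(2)[of "(s @ [d]) ! k"] False that by auto
        qed
        ultimately show ?thesis using 2(1) by auto
      qed
    qed (blast dest: two_take)
  qed
  have "invar f u T (s @ [d]) D' y' z' x'"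
    unfolding invar_def
  proof (intro conjI)
    show "\<forall>t\<in>D'. rgt y' t = lft z' t \<and> rgt z' t = lft x' t \<and> rgt x' t = lft y' t" using ag' by blast
    show "big (pairs T) D' y' (edges f u T (digits (length (s @ [d])) (s @ [d])))" using By by simp
    show "big (pairs T) D' z' (edges f u T (digits (length (s @ [d]) + 1) (s @ [d])))" using Bz by simp
    show "big (pairs T) D' x' (edges f u T (digits (length (s @ [d]) + 2) (s @ [d])))"
      using Bx by (simp add: numeral_3_eq_3)
    show "\<exists>V. small (length (s @ [d])) V \<and> comeagre_below D' (lft y') {z. u z \<in> V}" using Vy V2 by auto
    \<comment> \<open>The vertex \<open>lft z'\<close> joins the two edges not refined in this step,
      so it keeps the old precision; hence the weaker index in this clause.\<close>
    show "\<exists>V. small (length (s @ [d]) - 1) V \<and> comeagre_below D' (lft z') {z. u z \<in> V}" using Vz V3 by auto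
    show "\<exists>V. small (length (s @ [d])) V \<and> comeagre_below D' (lft x') {z. u z \<in> V}" using V1 by auto
    show "\<forall>t. t \<notin> D' \<longrightarrow> (\<forall>k<length t. take k t \<in> D') \<longrightarrow>
       two_of (dropped (strat y') t) (dropped (strat z') t) (dropped (strat x') t) \<or>
       length t \<le> length (s @ [d]) \<and> (\<forall>j<length t. (s @ [d]) ! j \<le> t ! j)"
      using fr unfolding two_def two_of_def st by auto
  qed (use D' cl y' z' x' in auto)
  then show ?thesis by blast
qed

text \<open>With empty domain the three conditions may coincide. All pairs are edges by hypothesis,
  the Baire category theorem makes them big, and the only frontier node is
  \<open>[]\<close>.\<close>

lemma invar_Nil:
  assumes T: "\<And>x. x \<in> pairs T \<Longrightarrow> (u (lft x), u (rgt x)) \<in> range f"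
  shows "\<exists>x. invar f u T [] {} x x x"
proof -
  define x :: cond where "x = (\<lambda>t. (True, False, 0))"
  have x: "x \<in> pairs T" by (simp add: pairs_def x_def)
  have "edges f u T UNIV = pairs T" using T by (force simp: edges_def image_iff)
  moreover have "big (pairs T) {} x (pairs T)"
    unfolding big_def
  proof (intro allI impI)
    fix D' x' assume "extends (pairs T) {} x D' x'"
    moreover have "pairs T \<inter> cylinder (pairs T) D' x' = cylinder (pairs T) D' x'" by (auto simp: cylinder_def)
    ultimately show "\<not> meagre (pairs T) (pairs T \<inter> cylinder (pairs T) D' x')"
      using not_meagre_cylinder[OF pointwise_closed_pairs] by (simp add: extends_def)
  qed
  moreover have "\<exists>V. small 0 V \<and> comeagre_below {} (lft x) {z. u z \<in> V}"
    by (rule exI[of _ UNIV]) (simp add: small_def comeagre_below_def meagre_empty)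
  ultimately have "invar f u T [] {} x x x"
    using x by (simp add: invar_def digits_Nil) (metis length_greater_0_conv)
  then show ?thesis by blast
qed

text \<open>A list with the invariant satisfies \<open>attempt f\<close>, and so do its prefixes;
  everything above them is then in \<open>T\<close>, as \<open>invar_step\<close> requires. The
  chosen digits form the branch.\<close>

theorem ex_attempt_branch:
  fixes u :: "(nat list \<Rightarrow> bool) \<Rightarrow> 'a::polish_space"
  assumes u: "BP_measurable u"
    and hom: "\<And>x. x \<in> pairs T \<Longrightarrow> (u (lft x), u (rgt x)) \<in> range f"
    and T: "\<And>s t. attempt f s \<Longrightarrow> length s = length t \<Longrightarrow> (\<And>j. j < length t \<Longrightarrow> s ! j \<le> t ! j) \<Longrightarrow> t \<in> T"
  shows "\<exists>g. \<forall>n. attempt f (map g [0..<n])"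
proof -
  define E where "E = (\<lambda>s. \<exists>D x y z. invar f u T s D x y z)"
  have E0: "E []" using invar_Nil[of T u f] hom unfolding E_def by blast
  have att: "attempt f s" if "E s" for s using that invar_attempt unfolding E_def by blast
  have "\<exists>d. E (s @ [d])" if "E s" for s
  proof -
    have "t \<in> T" if "length t \<le> length s" "\<And>j. j < length t \<Longrightarrow> s ! j \<le> t ! j" for t
      using that by (intro T[of "take (length t) s"] attempt_take att[OF \<open>E s\<close>]) auto
    then show ?thesis using that invar_step[OF _ u] unfolding E_def by meson
  qed
  then obtain c where c: "\<And>s. E s \<Longrightarrow> E (s @ [c s])" by metis
  define w where "w = rec_nat [] (\<lambda>_ s. s @ [c s])"
  have w: "w 0 = []" "w (Suc n) = w n @ [c (w n)]" for n by (simp_all add: w_def)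
  have "E (w n)" for n by (induction n) (simp_all add: w E0 c)
  moreover have "w n = map (\<lambda>i. c (w i)) [0..<n]" for n by (induction n) (simp_all add: w)
  ultimately show ?thesis using att by metis
qed

text \<open>An infinite descent yields a sequence \<open>b\<close> bounding lists with
  \<open>Q\<close> of every length; Koenig's lemma turns these into a branch.\<close>

lemma wf_if_no_attempt_branch:
  fixes Q :: "nat list \<Rightarrow> bool"
  assumes take: "\<And>s n. Q s \<Longrightarrow> Q (take n s)" and no: "\<not> (\<exists>g. \<forall>n. Q (map g [0..<n]))"
  shows "wf {(t @ [i], t) | t i. \<exists>s. Q s \<and> length s = length t \<and> (\<forall>j<length t. s ! j \<le> t ! j)}"
    (is "wf ?r")
proof (rule ccontr)
  assume "\<not> wf ?r"
  then obtain c where c: "\<And>n. (c (Suc n), c n) \<in> ?r" unfolding wf_iff_no_infinite_down_chain by blast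
  then have len: "length (c (Suc n)) = Suc (length (c n))" for n
  proof -
    obtain i where "c (Suc n) = c n @ [i]" using c[of n] by blast
    then show ?thesis by simp
  qed
  have ln: "n \<le> length (c n)" for n by (induction n) (use len in auto)
  have pre: "take (length (c m)) (c n) = c m" if "m \<le> n" for m n
    using that
  proof (induction n rule: dec_induct)
    case (step n)
    obtain i where "c (Suc n) = c n @ [i]" using c[of n] by auto
    moreover have "length (c m) \<le> length (c n)" using step.IH by (metis length_take min.cobounded1 nat_le_linear take_all)
    ultimately show ?case using step.IH by simp
  qed simp
  \<comment> \<open>The chain may start at any node, so \<open>c n\<close> has length at least
    \<open>n\<close>; its entry at position \<open>j\<close> is settled from
    \<open>c (Suc j)\<close> on.\<close>
  define b where "b = (\<lambda>j. c (Suc j) ! j)"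
  have b: "c n ! j = b j" if "j < n" for n j
    using pre[of "Suc j" n] that ln[of "Suc j"] unfolding b_def by (metis Suc_leI less_eq_Suc_le nth_take)
  have "\<exists>s. Q s \<and> length s = n \<and> (\<forall>j<n. s ! j \<le> b j)" for n
  proof -
    obtain s where s: "Q s" "length s = length (c n)" "\<And>j. j < length (c n) \<Longrightarrow> s ! j \<le> c n ! j"
      using c[of n] by blast
    have "s ! j \<le> b j" if "j < n" for j using s(3)[of j] b[OF that] ln[of n] that by simp
    then show ?thesis using take[OF s(1)] s(2) ln[of n] by (intro exI[of _ "take n s"]) auto
  qed
  then show False using koenig_bounded[of Q b] take no by blast
qed

section \<open>Evaluation of \<open>h\<close> along the well-founded tree\<close>

lemma ex_tree_recursion:
  assumes "wf {(t @ [i], t) | t i. t \<in> T}"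
  shows "\<exists>U. \<forall>t z. U t z = (if t \<in> T then h (\<lambda>i. U (t @ [i]) z) else if z t then a else b)"
proof -
  let ?r = "{(t @ [i], t) | t i. t \<in> T}"
  define F where "F = (\<lambda>U t z. if t \<in> T then h (\<lambda>i. U (t @ [i]) z) else if z t then a else b)"
  have "wfrec ?r F t z = (if t \<in> T then h (\<lambda>i. wfrec ?r F (t @ [i]) z) else if z t then a else b)" for t z
    by (subst wfrec[OF assms]) (simp add: F_def cut_apply)
  then show ?thesis by blast
qed

theorem theorem3p11:
  fixes G :: "('a::polish_space \<times> 'a) set"
  assumes "graph G"
    and "triangle_free G"
    and "analytic_set G"
    and "G \<noteq> {}"
  shows "\<not> (\<exists>h :: (nat \<Rightarrow> 'a) \<Rightarrow> 'a. h \<in> borel_measurable borel \<and> graph_hom (star_graph G) G h)"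
proof
  assume "\<exists>h :: (nat \<Rightarrow> 'a) \<Rightarrow> 'a. h \<in> borel_measurable borel \<and> graph_hom (star_graph G) G h"
  then obtain h :: "(nat \<Rightarrow> 'a) \<Rightarrow> 'a" where h: "h \<in> borel_measurable borel" "graph_hom (star_graph G) G h" by blast
  have "sym G" using assms(1) by (simp add: graph_def)
  obtain f :: "(nat \<Rightarrow> nat) \<Rightarrow> 'a \<times> 'a" where f: "continuous_on UNIV f" "G = range f"
    using assms(3,4) by (auto simp: analytic_set_def)
  obtain a b where ab: "(a, b) \<in> G" using assms(4) by auto
  then have ba: "(b, a) \<in> G" using \<open>sym G\<close> by (simp add: symD)
  \<comment> \<open>The upward closure makes every list above an initial segment of the current one
    an inner node.\<close>
  define T where "T = {t. \<exists>s. attempt f s \<and> length s = length t \<and> (\<forall>j<length t. s ! j \<le> t ! j)}"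
  have no: "\<not> (\<exists>g. \<forall>n. attempt f (map g [0..<n]))"
    using attempt_branch_triangle[OF f(1)] assms(2) \<open>sym G\<close> f(2) by blast
  then have wf: "wf {(t @ [i], t) | t i. t \<in> T}"
    using wf_if_no_attempt_branch[of "attempt f", OF attempt_take] by (simp add: T_def)
  obtain U where U: "\<And>t z. U t z = (if t \<in> T then h (\<lambda>i. U (t @ [i]) z) else if z t then a else b)"
    using ex_tree_recursion[OF wf, of h a b] by blast
  \<comment> \<open>Induction from the leaves: children with index at least \<open>strat x t\<close>
    are not dropped, so the two sequences of child values are adjacent in
    \<open>star_graph G\<close> and \<open>h\<close> gives an edge.\<close>
  have hom: "(U t (lft x), U t (rgt x)) \<in> G" if x: "x \<in> pairs T" and "\<not> dropped (strat x) t" for x t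
    using wf that(2)
  proof (induction t rule: wf_induct_rule)
    case (less t)
    show ?case
    proof (cases "t \<in> T")
      case True
      have "(U (t @ [i]) (lft x), U (t @ [i]) (rgt x)) \<in> G" if "i \<ge> strat x t" for i
      proof (rule less.IH)
        show "\<not> dropped (strat x) (t @ [i])"
          using less.prems that by (auto simp: dropped_def nth_append less_Suc_eq)
      qed (use True in auto)
      then have "((\<lambda>i. U (t @ [i]) (lft x)), (\<lambda>i. U (t @ [i]) (rgt x))) \<in> star_graph G"
        by (auto simp: star_graph_def)
      then show ?thesis using h(2) True by (simp add: graph_hom_def U[of t])
    next
      case False
      then have "lft x t \<noteq> rgt x t" using x less.prems by (auto simp: pairs_def)
      then show ?thesis using False ab ba by (auto simp: U[of t])
    qed
  qed
  \<comment> \<open>With the sets having the Baire property as measurable sets, Borel measurability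
    of \<open>h\<close> passes up the tree by composition.\<close>
  define M :: "(nat list \<Rightarrow> bool) measure" where "M = sigma UNIV {B. BP B}"
  have M: "sets M = {B. BP B}" "space M = UNIV"
    unfolding M_def using sigma_algebra.sets_measure_of_eq[OF sigma_algebra_BP]
    by (auto simp: space_measure_of_conv)
  have meas: "U t \<in> borel_measurable M" for t
    using wf
  proof (induction t rule: wf_induct_rule)
    case (less t)
    show ?case
    proof (cases "t \<in> T")
      case True
      have "(\<lambda>z i. U (t @ [i]) z) \<in> borel_measurable M"
        by (rule measurable_coordinatewise_then_product) (use less.IH True in auto)
      then have "(\<lambda>z. h (\<lambda>i. U (t @ [i]) z)) \<in> borel_measurable M"
        using measurable_compose h(1) by blast
      moreover have "U t = (\<lambda>z. h (\<lambda>i. U (t @ [i]) z))" using True U[of t] by auto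
      ultimately show ?thesis by simp
    next
      case False
      have "{z \<in> space M. z t} \<in> sets M" using BP_coordinate[of "\<lambda>b. b" t] by (simp add: M)
      then have "(\<lambda>z. if z t then a else b) \<in> borel_measurable M" by (intro measurable_If) auto
      moreover have "U t = (\<lambda>z. if z t then a else b)" using False U[of t] by auto
      ultimately show ?thesis by simp
    qed
  qed
  have "BP_measurable (U [])"
    unfolding BP_measurable_def
  proof (intro allI impI)
    fix V :: "'a set" assume "open V"
    then have "U [] -` V \<inter> space M \<in> sets M" by (intro measurable_sets[OF meas]) simp
    then show "BP {z. U [] z \<in> V}" by (simp add: M vimage_def)
  qed
  \<comment> \<open>No strategy drops the root \<open>[]\<close>, so \<open>hom\<close> applies to
    all of \<open>pairs T\<close> there.\<close>
  then have "\<exists>g. \<forall>n. attempt f (map g [0..<n])"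
    by (rule ex_attempt_branch[where T = T]) (use hom f(2) in \<open>auto simp: T_def dropped_def\<close>)
  with no show False by contradiction
qed

end
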